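(* Let $t$ be an even positive integer and let $n$ be a positive integer. Then $\Phi_t(n) = d(n)$ and $\Phi_t^+(n) = d(n,\theta)$, where $\theta = \frac{1}{2} + \sqrt{\frac{2n}{t} + \frac{1}{4}}$.
   Context: For $k \in \mathbb{N}$, $t \in \mathbb{N}_0$, $a \in \mathbb{Z}$, let $s_{k,t}(a) = \sum_{i=0}^{k-1}(a+it) = ka + \frac{k(k-1)t}{2}$. Define $\Phi_t(n) = |\{(k,a) \in \mathbb{N}\times\mathbb{Z} : s_{k,t}(a) = n\}|$, the number of representations of $n$ as a sum of a finite arithmetic progression of integers with difference $t$, and $\Phi_t^+(n) = |\{(k,a) \in \mathbb{N}\times\mathbb{N} : s_{k,t}(a) = n\}|$, the number of such representations in which all terms are positive. Here $d(n)$ is the number of positive divisors of $n$, and for a real number $\theta$, $d(n,\theta)$ is the number of positive divisors $d$ of $n$ with $d < \theta$. *)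

theory Defs
  imports Complex_Main
begin

definition ap_sum :: "nat \<Rightarrow> nat \<Rightarrow> int \<Rightarrow> int" where
  "ap_sum k t a = (\<Sum>i<k. a + int i * int t)"

text \<open>The naturals of the source are the positive integers (zero is included only where
  written explicitly), hence the conditions on k, and on a in the second count.\<close>

definition Phi :: "nat \<Rightarrow> nat \<Rightarrow> nat" where
  "Phi t n = card {(k :: nat, a :: int). k > 0 \<and> ap_sum k t a = int n}"

definition Phi_pos :: "nat \<Rightarrow> nat \<Rightarrow> nat" where
  "Phi_pos t n = card {(k :: nat, a :: nat). k > 0 \<and> a > 0 \<and> ap_sum k t (int a) = int n}"

definition num_divisors :: "nat \<Rightarrow> nat" where
  "num_divisors n = card {d :: nat. d > 0 \<and> d dvd n}"

definition num_divisors_below :: "nat \<Rightarrow> real \<Rightarrow> nat" where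
  "num_divisors_below n \<theta> = card {d :: nat. d > 0 \<and> d dvd n \<and> real d < \<theta>}"

end

theory Submission
  imports Defs
begin

text \<open>For \<open>t = 2m\<close> the sum of the progression is \<open>k(a + (k - 1)m)\<close>. Hence the length \<open>k\<close> divides
  \<open>n\<close>, and each divisor \<open>k\<close> determines exactly one integer \<open>a = n/k - (k - 1)m\<close>. This \<open>a\<close> is positive
  iff \<open>k(k - 1) < 2n/t\<close>; completing the square turns this into \<open>k < \<theta>\<close>.\<close>

text \<open>The even difference absorbs the denominator in \<open>k(k - 1)t/2\<close>, so
  \<open>k\<close> splits off as an integer factor. Subtracting in the integers avoids truncation at
  \<open>k = 0\<close>.\<close>

lemma ap_sum_even_difference: "ap_sum k (2 * m) a = int k * (a + (int k - 1) * int m)"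
  unfolding ap_sum_def by (induction k) (auto simp: algebra_simps)

lemma ap_sum_even_difference_eq_iff:
  assumes "k > 0"
  shows "ap_sum k (2 * m) a = int n \<longleftrightarrow> k dvd n \<and> a = int (n div k) - (int k - 1) * int m"
proof
  assume "ap_sum k (2 * m) a = int n"
  then have n: "int n = int k * (a + (int k - 1) * int m)"
    by (simp add: ap_sum_even_difference)
  then have "int k dvd int n" by simp
  moreover have "int (n div k) = a + (int k - 1) * int m"
    using n assms by (simp add: zdiv_int)
  ultimately show "k dvd n \<and> a = int (n div k) - (int k - 1) * int m" by simp
next
  assume "k dvd n \<and> a = int (n div k) - (int k - 1) * int m"
  then show "ap_sum k (2 * m) a = int n"
    by (simp add: ap_sum_even_difference flip: of_nat_mult)
qed

lemma first_term_pos_iff: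
  assumes "m > 0" "k > 0" "k dvd n"
  shows "int (n div k) - (int k - 1) * int m > 0
    \<longleftrightarrow> real k < 1 / 2 + sqrt (2 * real n / real (2 * m) + 1 / 4)"
proof -
  obtain q where n: "n = k * q" using assms(3) by blast
  have "int (n div k) - (int k - 1) * int m > 0 \<longleftrightarrow> (int k - 1) * int m < int q"
    using n assms(2) by simp
  also have "\<dots> \<longleftrightarrow> real_of_int ((int k - 1) * int m) < real_of_int (int q)"
    by (simp only: of_int_less_iff)
  \<comment> \<open>Multiplying by \<open>k\<close> > 0 trades the quotient \<open>q\<close> for
    \<open>n = k * q\<close>.\<close>
  also have "\<dots> \<longleftrightarrow> real k * ((real k - 1) * real m) < real k * real q"
    using assms(2) by simp
  also have "\<dots> \<longleftrightarrow> real k * (real k - 1) < real n / real m"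
    using assms(1) n by (simp add: field_simps)
  also have "\<dots> \<longleftrightarrow> (real k - 1 / 2)\<^sup>2 < 2 * real n / real (2 * m) + 1 / 4"
    by (simp add: power2_eq_square algebra_simps)
  also have "\<dots> \<longleftrightarrow> real k - 1 / 2 < sqrt (2 * real n / real (2 * m) + 1 / 4)"
  proof -
    \<comment> \<open>The root of the square is the absolute value; \<open>k\<close> \<ge> 1 removes
      the bars.\<close>
    have "real k - 1 / 2 \<ge> 0" using assms(2) by linarith
    then show ?thesis
      using real_sqrt_less_iff[of "(real k - 1 / 2)\<^sup>2"] by simp
  qed
  finally show ?thesis by linarith
qed

theorem theorem3:
  fixes t n :: nat
  assumes "even t" and "t > 0" and "n > 0"
  shows "Phi t n = num_divisors n \<and>
         Phi_pos t n = num_divisors_below n (1 / 2 + sqrt (2 * real n / real t + 1 / 4))"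
proof -
  obtain m where t: "t = 2 * m" using assms(1) by blast
  then have m: "m > 0" using assms(2) by simp
  define \<theta> where "\<theta> = 1 / 2 + sqrt (2 * real n / real t + 1 / 4)"
  define f where "f k = int (n div k) - (int k - 1) * int m" for k
  have sum_iff: "ap_sum k t a = int n \<longleftrightarrow> k dvd n \<and> a = f k" if "k > 0" for k a
    using ap_sum_even_difference_eq_iff[OF that] by (simp add: t f_def)
  have pos_iff: "f k > 0 \<longleftrightarrow> real k < \<theta>" if "k > 0" "k dvd n" for k
    using first_term_pos_iff[OF m that] by (simp only: t f_def \<theta>_def)
  have "{(k :: nat, a :: int). k > 0 \<and> ap_sum k t a = int n}
      = (\<lambda>k. (k, f k)) ` {d. d > 0 \<and> d dvd n}"
    using sum_iff by auto
  \<comment> \<open>The first component recovers \<open>k\<close>, so the map is injective and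
    preserves cardinality.\<close>
  then have "Phi t n = num_divisors n"
    by (simp add: Phi_def num_divisors_def card_image inj_on_def)
  moreover have "{(k :: nat, a :: nat). k > 0 \<and> a > 0 \<and> ap_sum k t (int a) = int n}
      = (\<lambda>k. (k, nat (f k))) ` {d. d > 0 \<and> d dvd n \<and> real d < \<theta>}"
  proof -
    \<comment> \<open>\<open>nat\<close> sends a negative \<open>f k\<close> to 0, but the bound
      \<open>real k < \<theta>\<close> makes \<open>f k\<close> positive, so
      \<open>a = nat (f k)\<close> is the same as \<open>int a = f k\<close> and forces
      \<open>a > 0\<close>.\<close>
    have "k > 0 \<and> a > 0 \<and> ap_sum k t (int a) = int n
        \<longleftrightarrow> k > 0 \<and> k dvd n \<and> real k < \<theta> \<and> a = nat (f k)" for k a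
      using sum_iff[of k "int a"] pos_iff[of k] by auto
    then show ?thesis by auto
  qed
  then have "Phi_pos t n = num_divisors_below n \<theta>"
    by (simp add: Phi_pos_def num_divisors_below_def card_image inj_on_def)
  ultimately show ?thesis by (simp add: \<theta>_def)
qed

end
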